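(* Let $\phi$ be an analytic selfmap of $\mathbb{U}$ with Denjoy-Wolff point $\omega\in\partial\mathbb{U}$. Suppose that $\phi\in C^2(\omega)$ is such that $\phi'(\omega)=1$ and $\mathrm{Re}(\omega\phi''(\omega))>0$. If $\lambda\notin\{0,1\}$ is an eigenvalue of $C_\phi: H^2(\mathbb{U})\to H^2(\mathbb{U})$, then $\lambda$ is not an isolated point of $\mathrm{Sp}(C_\phi)$.
   Context: $\mathbb{U}$ is the open unit disc in $\mathbb{C}$ and $H^2(\mathbb{U})$ is the classical Hardy space of analytic functions on $\mathbb{U}$ with square-summable Maclaurin coefficients. An analytic selfmap of $\mathbb{U}$ is an analytic function $\phi$ on $\mathbb{U}$ with $\phi(\mathbb{U})\subseteq\mathbb{U}$; $C_\phi f=f\circ\phi$ is the composition operator, which is bounded on $H^2(\mathbb{U})$. $\mathrm{Sp}(C_\phi)$ denotes its spectrum. If $\phi$ is not an elliptic automorphism of $\mathbb{U}$, its Denjoy-Wolff point is the unique $\omega$ in the closed disc with $\phi^{[n]}(z)\to\omega$ for each $z\in\mathbb{U}$, where $\phi^{[n]}$ is the $n$-th iterate; if $|\omega|=1$ then $\phi(\omega)=\omega$ (angular limit). For $\zeta\in\partial\mathbb{U}$, $\phi\in C^2(\zeta)$ means that $\phi$ is differentiable at $\zeta$ up to order $2$ (viewed as a function with domain $\mathbb{U}\cup\{\zeta\}$) and, for $z\in\mathbb{U}$, $\phi(z)=\sum_{k=0}^2\frac{\phi^{(k)}(\zeta)}{k!}(z-\zeta)^k+\gamma(z)$ with $\gamma(z)=o(|z-\zeta|^2)$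 as $z\to\zeta$ from within $\mathbb{U}$. *)

theory Defs
  imports "HOL-Complex_Analysis.Complex_Analysis" "HOL-Library.Landau_Symbols"
begin

abbreviation unit_disc :: "complex set" where
  "unit_disc \<equiv> ball 0 1"

definition analytic_selfmap :: "(complex \<Rightarrow> complex) \<Rightarrow> bool" where
  "analytic_selfmap \<phi> \<longleftrightarrow> \<phi> holomorphic_on unit_disc \<and> \<phi> ` unit_disc \<subseteq> unit_disc"

definition maclaurin_coeff :: "(complex \<Rightarrow> complex) \<Rightarrow> nat \<Rightarrow> complex" where
  "maclaurin_coeff f n = (deriv ^^ n) f 0 / fact n"

text \<open>
  A function on the disc is represented by its extension by 0 to the whole plane. Thus
  equality of elements of \<open>hardy2\<close> is equality in HOL, and \<open>hardy2\<close> is a complex vector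
  space under the pointwise operations.
\<close>

definition hardy2 :: "(complex \<Rightarrow> complex) set" where
  "hardy2 = {f. f holomorphic_on unit_disc \<and> (\<forall>z. z \<notin> unit_disc \<longrightarrow> f z = 0) \<and>
                summable (\<lambda>n. (cmod (maclaurin_coeff f n))\<^sup>2)}"

definition hardy2_norm :: "(complex \<Rightarrow> complex) \<Rightarrow> real" where
  "hardy2_norm f = sqrt (\<Sum>n. (cmod (maclaurin_coeff f n))\<^sup>2)"

definition comp_op :: "(complex \<Rightarrow> complex) \<Rightarrow> (complex \<Rightarrow> complex) \<Rightarrow> complex \<Rightarrow> complex" where
  "comp_op \<phi> f = (\<lambda>z. if z \<in> unit_disc then f (\<phi> z) else 0)"

definition bounded_operator_hardy2 :: "((complex \<Rightarrow> complex) \<Rightarrow> complex \<Rightarrow> complex) \<Rightarrow> bool" where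
  "bounded_operator_hardy2 T \<longleftrightarrow>
     (\<forall>f\<in>hardy2. T f \<in> hardy2) \<and>
     (\<forall>f\<in>hardy2. \<forall>g\<in>hardy2. T (\<lambda>z. f z + g z) = (\<lambda>z. T f z + T g z)) \<and>
     (\<forall>c. \<forall>f\<in>hardy2. T (\<lambda>z. c * f z) = (\<lambda>z. c * T f z)) \<and>
     (\<exists>K. \<forall>f\<in>hardy2. hardy2_norm (T f) \<le> K * hardy2_norm f)"

definition spectrum_hardy2 :: "((complex \<Rightarrow> complex) \<Rightarrow> complex \<Rightarrow> complex) \<Rightarrow> complex set" where
  "spectrum_hardy2 T = {\<mu>. \<not> (\<exists>S. bounded_operator_hardy2 S \<and>
     (\<forall>f\<in>hardy2. S (\<lambda>z. T f z - \<mu> * f z) = f \<and> (\<lambda>z. T (S f) z - \<mu> * S f z) = f))}"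

definition eigenvalue_hardy2 :: "((complex \<Rightarrow> complex) \<Rightarrow> complex \<Rightarrow> complex) \<Rightarrow> complex \<Rightarrow> bool" where
  "eigenvalue_hardy2 T \<mu> \<longleftrightarrow> (\<exists>f\<in>hardy2. f \<noteq> (\<lambda>z. 0) \<and> T f = (\<lambda>z. \<mu> * f z))"

text \<open>
  Elliptic automorphisms (including the identity) need no separate exclusion below: no point
  attracts every orbit of such a map.
\<close>

definition denjoy_wolff_point :: "(complex \<Rightarrow> complex) \<Rightarrow> complex \<Rightarrow> bool" where
  "denjoy_wolff_point \<phi> \<omega> \<longleftrightarrow>
     \<omega> \<in> cball 0 1 \<and> (\<forall>z\<in>unit_disc. (\<lambda>n. (\<phi> ^^ n) z) \<longlonglongrightarrow> \<omega>)"

text \<open>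
  \<open>has_C2_at \<phi> \<zeta> c0 c1 c2\<close>: \<open>\<phi>\<close> belongs to \<open>C\<^sup>2(\<zeta>)\<close>, with \<open>\<phi>(\<zeta>) = c0\<close>, \<open>\<phi>'(\<zeta>) = c1\<close> and
  \<open>\<phi>''(\<zeta>) = c2\<close>. Only the values of \<open>\<phi>\<close> on the disc matter: the first derivative at \<open>\<zeta>\<close> is that
  of \<open>\<phi>\<close> extended by \<open>c0\<close>, the second that of \<open>\<phi>'\<close> extended by \<open>c1\<close>, both relative to
  the disc together with \<open>\<zeta>\<close>. For \<open>\<zeta>\<close> on the circle, \<open>c0\<close>, \<open>c1\<close> and \<open>c2\<close> are
  therefore uniquely determined.
\<close>

definition has_C2_at ::
  "(complex \<Rightarrow> complex) \<Rightarrow> complex \<Rightarrow> complex \<Rightarrow> complex \<Rightarrow> complex \<Rightarrow> bool" where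
  "has_C2_at \<phi> \<zeta> c0 c1 c2 \<longleftrightarrow>
     (\<phi>(\<zeta> := c0) has_field_derivative c1) (at \<zeta> within insert \<zeta> unit_disc) \<and>
     ((deriv \<phi>)(\<zeta> := c1) has_field_derivative c2) (at \<zeta> within insert \<zeta> unit_disc) \<and>
     (\<lambda>z. \<phi> z - (c0 + c1 * (z - \<zeta>) + c2 / 2 * (z - \<zeta>)\<^sup>2))
       \<in> o[at \<zeta> within unit_disc](\<lambda>z. (z - \<zeta>)\<^sup>2)"

end

theory Submission
  imports Defs
begin

text \<open>
  An eigenfunction \<open>f\<close> with \<open>f \<circ> \<phi> = \<mu> f\<close> has no zeros: the orbit of a zero would
  consist of zeros, and in the coordinate \<open>v = \<omega> / (\<omega> - z)\<close>, in which \<open>\<phi>\<close> is asymptotically the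
  translation by \<open>\<omega> \<phi>''(\<omega>) / 2\<close>, that orbit tends to infinity at linear speed and
  non-tangentially. Hence \<open>1 - \<bar>z\<^sub>n\<bar>\<close> is at least of order \<open>1 / n\<close>, contrary to the Blaschke
  condition. So \<open>f = exp h\<close> with \<open>h \<circ> \<phi> = h + c\<close>, where \<open>exp c = \<mu>\<close> and \<open>c \<noteq> 0\<close>. For \<open>0 < s < 1\<close>
  the function \<open>exp (s h)\<close> is in the Hardy space because \<open>\<bar>f\<bar>\<^bsup>2s\<^esup> \<le> 1 + \<bar>f\<bar>\<^sup>2\<close>, so \<open>exp (s c)\<close>
  is an eigenvalue, and these eigenvalues accumulate at \<open>\<mu>\<close> as \<open>s \<rightarrow> 1\<close>.
\<close>

section \<open>Integral means over circles and membership in the Hardy space\<close>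

text \<open>Parametrising by \<open>{0..1}\<close> gives the circle total mass 1, and no root is
  taken, so Parseval's identity becomes an exact power series in the squared radius.\<close>

definition circle_mean :: "(complex \<Rightarrow> complex) \<Rightarrow> real \<Rightarrow> real" where
  "circle_mean f r = integral {0..1} (\<lambda>t. (cmod (f (of_real r * cis (2 * pi * t))))\<^sup>2)"

text \<open>Orthogonality of the characters of the circle. The frequency is an integer because it
  will be a difference of two exponents.\<close>

lemma has_integral_cis_int:
  fixes k :: int
  shows "((\<lambda>t. cis (2 * pi * of_int k * t)) has_integral (if k = 0 then 1 else 0)) {0..1}"
proof (cases "k = 0")
  case True
  with has_integral_const_real[of "1::complex" 0 1] show ?thesis by simp
next
  case False
  define c where "c = 2 * pi * of_int k"
  have c: "c \<noteq> 0" using False by (simp add: c_def)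
  have "((\<lambda>t. cis (c * t)) has_integral
      (cis (c * 1) / (\<i> * of_real c) - cis (c * 0) / (\<i> * of_real c))) {0..1}"
  proof (rule fundamental_theorem_of_calculus)
    fix x :: real
    have "((\<lambda>z. exp (\<i> * (of_real c * z)) / (\<i> * of_real c)) has_field_derivative
         exp (\<i> * (of_real c * of_real x))) (at (of_real x))"
      by (auto intro!: derivative_eq_intros simp: c field_simps)
    then have "((\<lambda>t. exp (\<i> * (of_real c * of_real t)) / (\<i> * of_real c)) has_vector_derivative
         exp (\<i> * (of_real c * of_real x))) (at x within {0..1})"
      by (rule has_vector_derivative_real_field)
    then show "((\<lambda>t. cis (c * t) / (\<i> * of_real c)) has_vector_derivative cis (c * x))
        (at x within {0..1})"
      by (simp add: cis_conv_exp)
  qed simp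
  moreover have "cis (c * 1) = 1"
    unfolding c_def by (metis cis_multiple_2pi Ints_of_int mult.right_neutral)
  ultimately show ?thesis using False by (simp add: c_def)
qed

text \<open>Finite Parseval: the squared modulus expands into a double sum of characters with
  frequencies \<open>n - m\<close>, and only the diagonal survives integration.\<close>

lemma has_integral_norm_trig_poly:
  fixes c :: "nat \<Rightarrow> complex"
  shows "((\<lambda>t. (cmod (\<Sum>n<N. c n * cis (2 * pi * t) ^ n))\<^sup>2) has_integral
     (\<Sum>n<N. (cmod (c n))\<^sup>2)) {0..1}"
proof -
  have pw: "complex_of_real ((cmod (\<Sum>n<N. c n * cis (2 * pi * t) ^ n))\<^sup>2) =
      (\<Sum>n<N. \<Sum>m<N. c n * cnj (c m) * cis (2 * pi * of_int (int n - int m) * t))" for t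
    unfolding complex_norm_square cnj_sum sum_product
  proof (intro sum.cong refl)
    fix n m
    have "cis (2 * pi * t) ^ n * cnj (cis (2 * pi * t) ^ m)
        = cis (2 * pi * of_int (int n - int m) * t)"
      unfolding complex_cnj_power cis_cnj Complex.DeMoivre cis_mult
      by (rule arg_cong[where f = cis]) (simp add: algebra_simps)
    then show "c n * cis (2 * pi * t) ^ n * cnj (c m * cis (2 * pi * t) ^ m)
        = c n * cnj (c m) * cis (2 * pi * of_int (int n - int m) * t)"
      by (metis (no_types, lifting) complex_cnj_mult mult.assoc mult.left_commute)
  qed
  have "((\<lambda>t. \<Sum>n<N. \<Sum>m<N. c n * cnj (c m) * cis (2 * pi * of_int (int n - int m) * t)) has_integral
     (\<Sum>n<N. \<Sum>m<N. c n * cnj (c m) * (if int n - int m = 0 then 1 else 0))) {0..1}"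
    by (intro has_integral_sum finite_lessThan has_integral_mult_right has_integral_cis_int)
  also have "(\<Sum>n<N. \<Sum>m<N. c n * cnj (c m) * (if int n - int m = 0 then 1 else 0)) =
      (\<Sum>n<N. \<Sum>m<N. if n = m then c n * cnj (c n) else 0)"
    by (intro sum.cong refl) auto
  also have "\<dots> = complex_of_real (\<Sum>n<N. (cmod (c n))\<^sup>2)"
    by (simp add: complex_norm_square del: of_real_power)
  finally have "((\<lambda>t. complex_of_real ((cmod (\<Sum>n<N. c n * cis (2 * pi * t) ^ n))\<^sup>2)) has_integral
      complex_of_real (\<Sum>n<N. (cmod (c n))\<^sup>2)) {0..1}"
    unfolding pw .
  from has_integral_linear[OF this bounded_linear_Re] show ?thesis
    by (simp add: o_def del: of_real_power)
qed

lemma circle_point_in_disc: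
  assumes "0 \<le> r" "r < 1"
  shows "of_real r * cis t \<in> unit_disc"
  using assms by (simp add: norm_mult)

lemma maclaurin_sums:
  assumes "f holomorphic_on unit_disc" "z \<in> unit_disc"
  shows "(\<lambda>n. maclaurin_coeff f n * z ^ n) sums f z"
  using holomorphic_power_series[OF assms] by (simp add: maclaurin_coeff_def)

lemma maclaurin_abs_summable:
  assumes f: "f holomorphic_on unit_disc" and r: "0 \<le> r" "r < 1"
  shows "summable (\<lambda>n. cmod (maclaurin_coeff f n) * r ^ n)"
proof -
  \<comment> \<open>Convergence at a point of modulus \<open>s > r\<close> upgrades to absolute
    convergence at radius \<open>r\<close>.\<close>
  obtain s where s: "r < s" "s < 1" using r dense by blast
  have "summable (\<lambda>n. maclaurin_coeff f n * of_real s ^ n)"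
    using maclaurin_sums[OF f, of "of_real s"] s r by (auto simp: sums_iff)
  then have "summable (\<lambda>n. cmod (maclaurin_coeff f n * of_real r ^ n))"
    by (rule powser_insidea) (use s r in simp)
  then show ?thesis using r by (simp add: norm_mult norm_power)
qed

text \<open>Parseval on the circle of radius \<open>r\<close>. The finite version applies to the
  Taylor polynomials; dominated convergence passes to the limit, with the square of the absolute sum
  \<open>A\<close> as constant majorant.\<close>

lemma circle_mean_sums:
  assumes f: "f holomorphic_on unit_disc" and r: "0 \<le> r" "r < 1"
  shows "(\<lambda>n. (cmod (maclaurin_coeff f n))\<^sup>2 * r ^ (2 * n)) sums circle_mean f r"
proof -
  define a where "a n = maclaurin_coeff f n * of_real r ^ n" for n
  define A where "A = (\<Sum>n. cmod (a n))"
  have sa: "summable (\<lambda>n. cmod (a n))"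
    using maclaurin_abs_summable[OF f r] r by (simp add: a_def norm_mult norm_power)
  have int: "((\<lambda>t. (cmod (\<Sum>n<N. a n * cis (2 * pi * t) ^ n))\<^sup>2) has_integral
     (\<Sum>n<N. (cmod (a n))\<^sup>2)) {0..1}" for N
    by (rule has_integral_norm_trig_poly)
  have "(\<lambda>N. integral {0..1} (\<lambda>t. (cmod (\<Sum>n<N. a n * cis (2 * pi * t) ^ n))\<^sup>2))
      \<longlonglongrightarrow> circle_mean f r"
    unfolding circle_mean_def
  proof (rule dominated_convergence(2))
    show "(\<lambda>t. (cmod (\<Sum>n<N. a n * cis (2 * pi * t) ^ n))\<^sup>2) integrable_on {0..1}" for N
      using int by blast
    show "(\<lambda>t::real. A\<^sup>2) integrable_on {0..1}"
      by (rule integrable_const_ivl)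
    show "norm ((cmod (\<Sum>n<N. a n * cis (2 * pi * t) ^ n))\<^sup>2) \<le> A\<^sup>2" for N t
    proof -
      have "cmod (\<Sum>n<N. a n * cis (2 * pi * t) ^ n) \<le> (\<Sum>n<N. cmod (a n))"
        by (rule order_trans[OF norm_sum]) (simp add: norm_mult norm_power)
      also have "\<dots> \<le> A" unfolding A_def by (rule sum_le_suminf[OF sa]) auto
      finally show ?thesis by (simp add: power_mono)
    qed
    show "(\<lambda>N. (cmod (\<Sum>n<N. a n * cis (2 * pi * t) ^ n))\<^sup>2) \<longlonglongrightarrow>
        (cmod (f (of_real r * cis (2 * pi * t))))\<^sup>2" for t
      using maclaurin_sums[OF f circle_point_in_disc[OF r, of "2 * pi * t"]]
      by (intro tendsto_intros) (simp add: sums_def a_def power_mult_distrib mult.assoc)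
  qed
  moreover have "integral {0..1} (\<lambda>t. (cmod (\<Sum>n<N. a n * cis (2 * pi * t) ^ n))\<^sup>2)
      = (\<Sum>n<N. (cmod (maclaurin_coeff f n))\<^sup>2 * r ^ (2 * n))" for N
    unfolding integral_unique[OF int]
    using r by (simp add: a_def norm_mult norm_power power_mult_distrib mult.commute flip: power_mult)
  ultimately show ?thesis by (simp add: sums_def)
qed

lemma circle_mean_mono:
  assumes f: "f holomorphic_on unit_disc" and r: "0 \<le> r" "r \<le> s" "s < 1"
  shows "circle_mean f r \<le> circle_mean f s"
proof (rule sums_le)
  show "(\<lambda>n. (cmod (maclaurin_coeff f n))\<^sup>2 * r ^ (2 * n)) sums circle_mean f r"
    by (rule circle_mean_sums) (use assms in auto)
  show "(\<lambda>n. (cmod (maclaurin_coeff f n))\<^sup>2 * s ^ (2 * n)) sums circle_mean f s"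
    by (rule circle_mean_sums) (use assms in auto)
qed (use r in \<open>auto intro!: mult_left_mono power_mono\<close>)

lemma circle_mean_integrable:
  assumes f: "f holomorphic_on unit_disc" and r: "0 \<le> r" "r < 1"
  shows "(\<lambda>t. (cmod (f (of_real r * cis (2 * pi * t))))\<^sup>2) integrable_on {0..1}"
proof (rule integrable_continuous_interval)
  have "continuous_on {0..1} (\<lambda>t. f (of_real r * cis (2 * pi * t)))"
    by (rule continuous_on_compose2[OF holomorphic_on_imp_continuous_on[OF f]])
       (use circle_point_in_disc[OF r] in \<open>auto intro!: continuous_intros\<close>)
  then show "continuous_on {0..1} (\<lambda>t. (cmod (f (of_real r * cis (2 * pi * t))))\<^sup>2)"
    by (intro continuous_intros)
qed

text \<open>By Parseval the means are the coefficient sums weighted by \<open>r ^ (2 * n)\<close>.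
  Weights at most 1 give one direction; letting r tend to 1 in each finite partial sum gives the
  other.\<close>

lemma hardy2_coeff_iff_circle_mean:
  assumes f: "f holomorphic_on unit_disc"
  shows "summable (\<lambda>n. (cmod (maclaurin_coeff f n))\<^sup>2) \<longleftrightarrow>
    (\<exists>K. \<forall>r. 0 \<le> r \<and> r < 1 \<longrightarrow> circle_mean f r \<le> K)"
proof
  assume s: "summable (\<lambda>n. (cmod (maclaurin_coeff f n))\<^sup>2)"
  have "circle_mean f r \<le> (\<Sum>n. (cmod (maclaurin_coeff f n))\<^sup>2)" if "0 \<le> r" "r < 1" for r
    by (rule sums_le[OF _ circle_mean_sums[OF f that] summable_sums[OF s]])
       (use that in \<open>auto intro!: mult_right_le_one_le power_le_one\<close>)
  then show "\<exists>K. \<forall>r. 0 \<le> r \<and> r < 1 \<longrightarrow> circle_mean f r \<le> K" by blast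
next
  assume "\<exists>K. \<forall>r. 0 \<le> r \<and> r < 1 \<longrightarrow> circle_mean f r \<le> K"
  then obtain K where K: "\<And>r. 0 \<le> r \<Longrightarrow> r < 1 \<Longrightarrow> circle_mean f r \<le> K" by blast
  have le: "(\<Sum>n<N. (cmod (maclaurin_coeff f n))\<^sup>2) \<le> K" for N
  proof (rule tendsto_upperbound)
    show "((\<lambda>r. \<Sum>n<N. (cmod (maclaurin_coeff f n))\<^sup>2 * r ^ (2 * n)) \<longlongrightarrow>
       (\<Sum>n<N. (cmod (maclaurin_coeff f n))\<^sup>2)) (at_left 1)"
      by (auto intro!: tendsto_eq_intros)
    have "\<forall>\<^sub>F r::real in at_left 1. r \<in> {0<..<1}"
      by (rule eventually_at_left_real) simp
    then show "\<forall>\<^sub>F r in at_left 1. (\<Sum>n<N. (cmod (maclaurin_coeff f n))\<^sup>2 * r ^ (2 * n)) \<le> K"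
    proof eventually_elim
      case (elim r)
      then have r: "0 \<le> r" "r < 1" by auto
      have "(\<Sum>n<N. (cmod (maclaurin_coeff f n))\<^sup>2 * r ^ (2 * n)) \<le> circle_mean f r"
        using circle_mean_sums[OF f r] r
        by (metis (no_types, lifting) sum_le_suminf sums_iff finite_lessThan zero_le_mult_iff
            zero_le_power zero_le_power2)
      with K[OF r] show ?case by linarith
    qed
  qed simp
  show "summable (\<lambda>n. (cmod (maclaurin_coeff f n))\<^sup>2)"
    \<comment> \<open>The criterion bounds sums over indices up to and including n, hence the shift
      from N to a successor.\<close>
    by (rule bounded_imp_summable[of _ K]) (use le[of "Suc _"] in \<open>auto simp: lessThan_Suc_atMost\<close>)
qed

text \<open>Each coefficient alone is at most \<open>sqrt K\<close>, so a geometric series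
  dominates. This crude growth bound suffices, since it is applied only at one fixed point.\<close>

lemma cmod_le_of_circle_mean_le:
  assumes f: "f holomorphic_on unit_disc"
    and K: "\<And>r. 0 \<le> r \<Longrightarrow> r < 1 \<Longrightarrow> circle_mean f r \<le> K" and z: "z \<in> unit_disc"
  shows "cmod (f z) \<le> sqrt K / (1 - cmod z)"
proof -
  have a: "cmod (maclaurin_coeff f n) \<le> sqrt K" for n
  proof (rule real_le_rsqrt, rule tendsto_upperbound)
    show "((\<lambda>r. (cmod (maclaurin_coeff f n))\<^sup>2 * r ^ (2 * n)) \<longlongrightarrow>
       (cmod (maclaurin_coeff f n))\<^sup>2) (at_left 1)"
      by (auto intro!: tendsto_eq_intros)
    have "\<forall>\<^sub>F r::real in at_left 1. r \<in> {0<..<1}"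
      by (rule eventually_at_left_real) simp
    then show "\<forall>\<^sub>F r in at_left 1. (cmod (maclaurin_coeff f n))\<^sup>2 * r ^ (2 * n) \<le> K"
    proof eventually_elim
      case (elim r)
      then have r: "0 \<le> r" "r < 1" by auto
      have "(\<Sum>k\<in>{n}. (cmod (maclaurin_coeff f k))\<^sup>2 * r ^ (2 * k)) \<le> circle_mean f r"
        unfolding sums_unique[OF circle_mean_sums[OF f r]]
        by (rule sum_le_suminf) (use circle_mean_sums[OF f r] r in \<open>auto simp: sums_iff\<close>)
      with K[OF r] show ?case by simp
    qed
  qed simp
  have g: "(\<lambda>n. sqrt K * cmod z ^ n) sums (sqrt K * (1 / (1 - cmod z)))"
    by (intro sums_mult geometric_sums) (use z in simp)
  have "cmod (\<Sum>n. maclaurin_coeff f n * z ^ n) \<le> (\<Sum>n. sqrt K * cmod z ^ n)"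
    by (rule norm_suminf_le)
       (use a g in \<open>auto simp: norm_mult norm_power sums_iff intro!: mult_right_mono\<close>)
  then show ?thesis
    using maclaurin_sums[OF f z] g by (simp add: sums_iff)
qed

section \<open>Blaschke factors and the Blaschke condition for zeros\<close>

lemma one_minus_cnj_mult_nonzero:
  assumes "a \<in> unit_disc" "z \<in> unit_disc"
  shows "1 - cnj a * z \<noteq> 0"
proof
  assume "1 - cnj a * z = 0"
  then have "cmod a * cmod z = 1"
    by (metis complex_mod_cnj eq_iff_diff_eq_0 norm_mult norm_one)
  moreover have "cmod a * cmod z < 1"
    using assms mult_strict_mono[of "cmod a" 1 "cmod z" 1] by simp
  ultimately show False by simp
qed

lemma norm_blaschke_factor:
  assumes "a \<in> unit_disc" "z \<in> unit_disc"
  shows "(cmod ((z - a) / (1 - cnj a * z)))\<^sup>2 =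
    1 - (1 - (cmod a)\<^sup>2) * (1 - (cmod z)\<^sup>2) / (cmod (1 - cnj a * z))\<^sup>2"
proof -
  have "(cmod (z - a))\<^sup>2 = (cmod (1 - cnj a * z))\<^sup>2 - (1 - (cmod a)\<^sup>2) * (1 - (cmod z)\<^sup>2)"
    unfolding cmod_power2 by (simp add: power2_eq_square algebra_simps)
  then show ?thesis
    using one_minus_cnj_mult_nonzero[OF assms]
    by (simp add: norm_divide power_divide diff_divide_distrib[of "_ ^ 2"])
qed

text \<open>For fixed \<open>a\<close> the lower bound depends only on the modulus of
  \<open>z\<close> and tends to 1 at the unit circle: near the boundary, division by the factor
  costs almost nothing.\<close>

lemma norm_blaschke_factor_ge:
  assumes "a \<in> unit_disc" "z \<in> unit_disc"
  shows "1 - (1 - (cmod a)\<^sup>2) / (1 - cmod a)\<^sup>2 * (1 - (cmod z)\<^sup>2)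
    \<le> (cmod ((z - a) / (1 - cnj a * z)))\<^sup>2"
proof -
  have "1 - cmod a \<le> 1 - cmod (cnj a * z)"
    using assms by (simp add: norm_mult mult_right_le_one_le)
  also have "\<dots> \<le> cmod (1 - cnj a * z)"
    by (metis norm_one norm_triangle_ineq2)
  finally have "(1 - cmod a)\<^sup>2 \<le> (cmod (1 - cnj a * z))\<^sup>2"
    using assms by (intro power_mono) auto
  moreover have "0 \<le> (1 - (cmod a)\<^sup>2) * (1 - (cmod z)\<^sup>2)"
    using assms by (simp add: power_le_one)
  ultimately have "(1 - (cmod a)\<^sup>2) * (1 - (cmod z)\<^sup>2) / (cmod (1 - cnj a * z))\<^sup>2
      \<le> (1 - (cmod a)\<^sup>2) * (1 - (cmod z)\<^sup>2) / (1 - cmod a)\<^sup>2"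
    using assms by (intro divide_left_mono mult_pos_pos) auto
  then show ?thesis unfolding norm_blaschke_factor[OF assms] by simp
qed

text \<open>Here \<open>z\<close> is the fixed point and \<open>a\<close> varies: at
  \<open>z\<close> the factor is smaller than 1 by an amount proportional to
  \<open>1 - (cmod a)\<^sup>2\<close>. The 4 comes from bounding the denominator by 2.\<close>

lemma norm_blaschke_factor_le:
  assumes "a \<in> unit_disc" "z \<in> unit_disc"
  shows "(cmod ((z - a) / (1 - cnj a * z)))\<^sup>2 \<le> 1 - (1 - (cmod z)\<^sup>2) / 4 * (1 - (cmod a)\<^sup>2)"
proof -
  have "cmod (1 - cnj a * z) \<le> 1 + cmod (cnj a * z)"
    by (metis norm_one norm_triangle_ineq4)
  also have "\<dots> \<le> 2"
    using assms by (simp add: norm_mult mult_le_one)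
  finally have "(cmod (1 - cnj a * z))\<^sup>2 \<le> 2\<^sup>2" by (intro power_mono) auto
  moreover have "0 \<le> (1 - (cmod a)\<^sup>2) * (1 - (cmod z)\<^sup>2)"
    using assms by (simp add: power_le_one)
  ultimately have "(1 - (cmod a)\<^sup>2) * (1 - (cmod z)\<^sup>2) / 2\<^sup>2
      \<le> (1 - (cmod a)\<^sup>2) * (1 - (cmod z)\<^sup>2) / (cmod (1 - cnj a * z))\<^sup>2"
    using one_minus_cnj_mult_nonzero[OF assms] by (intro divide_left_mono mult_pos_pos) auto
  then show ?thesis unfolding norm_blaschke_factor[OF assms] by (simp add: mult.commute)
qed

text \<open>A Blaschke factor has boundary modulus 1, so dividing it out should keep the bound
  \<open>K\<close> exactly. Without boundary values, this is obtained by comparing means on circles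
  of radius s and letting s tend to 1.\<close>

lemma divide_blaschke_factor:
  assumes f: "f holomorphic_on unit_disc" and a: "a \<in> unit_disc" and fa: "f a = 0"
    and K: "\<And>r. 0 \<le> r \<Longrightarrow> r < 1 \<Longrightarrow> circle_mean f r \<le> K"
  obtains g where "g holomorphic_on unit_disc"
    and "\<And>z. z \<in> unit_disc \<Longrightarrow> f z = (z - a) / (1 - cnj a * z) * g z"
    and "\<And>r. 0 \<le> r \<Longrightarrow> r < 1 \<Longrightarrow> circle_mean g r \<le> K"
proof
  \<comment> \<open>The value at \<open>a\<close> removes the singularity of the quotient.\<close>
  define q where "q z = (if z = a then deriv f a else (f z - f a) / (z - a))" for z
  define g where "g z = (1 - cnj a * z) * q z" for z
  have "q holomorphic_on unit_disc"
    unfolding q_def by (rule pole_lemma_open[OF f]) simp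
  then show g: "g holomorphic_on unit_disc"
    unfolding g_def by (intro holomorphic_intros)
  show fg: "f z = (z - a) / (1 - cnj a * z) * g z" if "z \<in> unit_disc" for z
    using one_minus_cnj_mult_nonzero[OF a that] fa by (simp add: g_def q_def)
  define C where "C = (1 - (cmod a)\<^sup>2) / (1 - cmod a)\<^sup>2"
  have le: "(1 - C * (1 - s\<^sup>2)) * circle_mean g s \<le> circle_mean f s" if s: "0 \<le> s" "s < 1" for s
  proof -
    have "(1 - C * (1 - s\<^sup>2)) * circle_mean g s = integral {0..1}
        (\<lambda>t. (1 - C * (1 - s\<^sup>2)) * (cmod (g (of_real s * cis (2 * pi * t))))\<^sup>2)"
      by (simp add: circle_mean_def)
    also have "\<dots> \<le> circle_mean f s"
      unfolding circle_mean_def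
    proof (rule integral_le)
      show "(\<lambda>t. (1 - C * (1 - s\<^sup>2)) * (cmod (g (of_real s * cis (2 * pi * t))))\<^sup>2)
          integrable_on {0..1}"
        by (intro integrable_on_mult_right circle_mean_integrable g s)
      show "(\<lambda>t. (cmod (f (of_real s * cis (2 * pi * t))))\<^sup>2) integrable_on {0..1}"
        by (rule circle_mean_integrable[OF f s])
      fix t :: real
      let ?z = "of_real s * cis (2 * pi * t)"
      have z: "?z \<in> unit_disc" by (rule circle_point_in_disc[OF s])
      have "cmod ?z = s" using s by (simp add: norm_mult)
      then show "(1 - C * (1 - s\<^sup>2)) * (cmod (g ?z))\<^sup>2 \<le> (cmod (f ?z))\<^sup>2"
        unfolding fg[OF z] norm_mult[of _ "g ?z"] power_mult_distrib
        using norm_blaschke_factor_ge[OF a z] by (intro mult_right_mono) (auto simp: C_def)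
    qed
    finally show ?thesis .
  qed
  fix r :: real assume r: "0 \<le> r" "r < 1"
  have lim: "((\<lambda>s. 1 - C * (1 - s\<^sup>2)) \<longlongrightarrow> 1) (at_left 1)"
    by (auto intro!: tendsto_eq_intros)
  \<comment> \<open>The comparison loses a factor at radius s, but monotonicity of the means of
    \<open>g\<close> moves it to the fixed radius \<open>r\<close>, where the loss disappears as s
    tends to 1.\<close>
  show "circle_mean g r \<le> K"
  proof (rule tendsto_upperbound)
    show "((\<lambda>s. (1 - C * (1 - s\<^sup>2)) * circle_mean g r) \<longlongrightarrow> circle_mean g r) (at_left 1)"
      using tendsto_mult_right[OF lim, of "circle_mean g r"] by simp
    have "\<forall>\<^sub>F s::real in at_left 1. s \<in> {r<..<1}"
      by (rule eventually_at_left_real) (use r in simp)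
    moreover have "\<forall>\<^sub>F s in at_left 1. 0 < 1 - C * (1 - s\<^sup>2)"
      using order_tendstoD(1)[OF lim, of 0] by simp
    ultimately show "\<forall>\<^sub>F s in at_left 1. (1 - C * (1 - s\<^sup>2)) * circle_mean g r \<le> K"
    proof eventually_elim
      case (elim s)
      have s: "0 \<le> s" "s < 1" "r \<le> s" using elim r by auto
      have "(1 - C * (1 - s\<^sup>2)) * circle_mean g r \<le> (1 - C * (1 - s\<^sup>2)) * circle_mean g s"
        using elim circle_mean_mono[OF g r(1) s(3,2)] by (intro mult_left_mono) auto
      with le[OF s(1,2)] K[OF s(1,2)] show ?case by linarith
    qed
  qed simp
qed

lemma divide_finite_blaschke_product:
  fixes z :: "nat \<Rightarrow> complex"
  assumes f: "f holomorphic_on unit_disc"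
    and K: "\<And>r. 0 \<le> r \<Longrightarrow> r < 1 \<Longrightarrow> circle_mean f r \<le> K"
    and z: "\<And>k. k < N \<Longrightarrow> z k \<in> unit_disc" "\<And>k. k < N \<Longrightarrow> f (z k) = 0" "inj_on z {..<N}"
  shows "\<exists>g. g holomorphic_on unit_disc \<and>
    (\<forall>w\<in>unit_disc. f w = (\<Prod>k<N. (w - z k) / (1 - cnj (z k) * w)) * g w) \<and>
    (\<forall>r. 0 \<le> r \<and> r < 1 \<longrightarrow> circle_mean g r \<le> K)"
  using z
proof (induction N)
  case 0
  then show ?case using f K by auto
next
  case (Suc N)
  have "inj_on z {..<N}" using Suc.prems(3) by (rule inj_on_subset) auto
  note IH = Suc.IH[OF Suc.prems(1,2) this, OF less_SucI less_SucI]
  obtain g where g: "g holomorphic_on unit_disc"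
      "\<And>w. w \<in> unit_disc \<Longrightarrow> f w = (\<Prod>k<N. (w - z k) / (1 - cnj (z k) * w)) * g w"
      "\<And>r. 0 \<le> r \<Longrightarrow> r < 1 \<Longrightarrow> circle_mean g r \<le> K"
    using IH by blast
  have zN: "z N \<in> unit_disc" using Suc.prems by simp
  \<comment> \<open>The zeros are distinct, so the factors already removed do not vanish at
    \<open>z N\<close>; the zero there must belong to the quotient \<open>g\<close>.\<close>
  have "(\<Prod>k<N. (z N - z k) / (1 - cnj (z k) * z N)) \<noteq> 0"
  proof -
    have "z N \<noteq> z k" if "k < N" for k
      using inj_onD[OF Suc.prems(3), of N k] that by auto
    moreover have "1 - cnj (z k) * z N \<noteq> 0" if "k < N" for k
      using that Suc.prems(1) by (intro one_minus_cnj_mult_nonzero) auto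
    ultimately show ?thesis by (simp add: right_minus_eq)
  qed
  moreover have "f (z N) = 0" using Suc.prems by simp
  ultimately have "g (z N) = 0" using g(2)[OF zN] by simp
  from divide_blaschke_factor[OF g(1) zN this g(3)]
  obtain h where h: "h holomorphic_on unit_disc"
     "\<And>w. w \<in> unit_disc \<Longrightarrow> g w = (w - z N) / (1 - cnj (z N) * w) * h w"
     "\<And>r. 0 \<le> r \<Longrightarrow> r < 1 \<Longrightarrow> circle_mean h r \<le> K" by blast
  show ?case
    using g(2) h by (intro exI[of _ h]) (simp add: mult.assoc)
qed

text \<open>Divide out the first N zeros and evaluate at \<open>w\<close>. The quotient is bounded
  there independently of N, while the product is at most the exponential of minus a multiple of the
  partial sum. As \<open>f w\<close> is not 0, the partial sums stay bounded.\<close>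

theorem hardy2_zeros_blaschke:
  fixes z :: "nat \<Rightarrow> complex"
  assumes f: "f \<in> hardy2"
    and z: "\<And>k. z k \<in> unit_disc" "\<And>k. f (z k) = 0" "inj z"
    and w: "f w \<noteq> 0"
  shows "summable (\<lambda>k. 1 - (cmod (z k))\<^sup>2)"
proof -
  \<comment> \<open>Members of \<open>hardy2\<close> vanish off the disc, so
    \<open>f w \<noteq> 0\<close> places \<open>w\<close> inside it.\<close>
  have fh: "f holomorphic_on unit_disc" and wd: "w \<in> unit_disc"
    using f w by (auto simp: hardy2_def simp del: mem_ball)
  obtain K where K: "\<And>r. 0 \<le> r \<Longrightarrow> r < 1 \<Longrightarrow> circle_mean f r \<le> K"
    using f hardy2_coeff_iff_circle_mean[OF fh] by (auto simp: hardy2_def)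
  define D where "D = (sqrt K / (1 - cmod w))\<^sup>2"
  define c where "c = (1 - (cmod w)\<^sup>2) / 4"
  have c: "c > 0" using wd by (simp add: c_def power_less_one_iff abs_square_less_1)
  have nn: "0 \<le> 1 - (cmod (z k))\<^sup>2" for k
    using z(1)[of k] by (simp add: power_le_one)
  have le: "(\<Sum>k<N. 1 - (cmod (z k))\<^sup>2) \<le> D / (cmod (f w))\<^sup>2 / c" for N
  proof -
    have "\<exists>g. g holomorphic_on unit_disc \<and>
        (\<forall>w\<in>unit_disc. f w = (\<Prod>k<N. (w - z k) / (1 - cnj (z k) * w)) * g w) \<and>
        (\<forall>r. 0 \<le> r \<and> r < 1 \<longrightarrow> circle_mean g r \<le> K)"
      by (rule divide_finite_blaschke_product[OF fh K z(1,2) inj_on_subset[OF z(3) subset_UNIV]])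
    then obtain g where g: "g holomorphic_on unit_disc"
      "\<And>w. w \<in> unit_disc \<Longrightarrow> f w = (\<Prod>k<N. (w - z k) / (1 - cnj (z k) * w)) * g w"
      "\<And>r. 0 \<le> r \<Longrightarrow> r < 1 \<Longrightarrow> circle_mean g r \<le> K"
      by blast
    let ?S = "\<Sum>k<N. 1 - (cmod (z k))\<^sup>2"
    have "(cmod (f w))\<^sup>2 = (\<Prod>k<N. (cmod ((w - z k) / (1 - cnj (z k) * w)))\<^sup>2) * (cmod (g w))\<^sup>2"
      by (simp only: g(2)[OF wd] norm_mult prod_norm[symmetric] power_mult_distrib prod_power_distrib)
    also have "\<dots> \<le> (\<Prod>k<N. exp (- (c * (1 - (cmod (z k))\<^sup>2)))) * D"
    proof (rule mult_mono)
      show "(\<Prod>k<N. (cmod ((w - z k) / (1 - cnj (z k) * w)))\<^sup>2)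
          \<le> (\<Prod>k<N. exp (- (c * (1 - (cmod (z k))\<^sup>2))))"
      proof (rule prod_mono, intro conjI)
        fix k
        have "(cmod ((w - z k) / (1 - cnj (z k) * w)))\<^sup>2 \<le> 1 - c * (1 - (cmod (z k))\<^sup>2)"
          using norm_blaschke_factor_le[OF z(1) wd] by (simp add: c_def)
        also have "\<dots> \<le> exp (- (c * (1 - (cmod (z k))\<^sup>2)))"
          using exp_ge_add_one_self[of "- (c * (1 - (cmod (z k))\<^sup>2))"] by linarith
        finally show "(cmod ((w - z k) / (1 - cnj (z k) * w)))\<^sup>2
            \<le> exp (- (c * (1 - (cmod (z k))\<^sup>2)))" .
      qed simp
      show "(cmod (g w))\<^sup>2 \<le> D"
        unfolding D_def using cmod_le_of_circle_mean_le[OF g(1,3) wd] by (simp add: power_mono)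
    qed (auto intro!: prod_nonneg)
    also have "(\<Prod>k<N. exp (- (c * (1 - (cmod (z k))\<^sup>2)))) = exp (- (c * ?S))"
      by (simp add: exp_sum[symmetric] sum_negf sum_distrib_left)
    finally have "exp (c * ?S) * (cmod (f w))\<^sup>2 \<le> D"
      by (simp add: exp_minus field_simps)
    moreover have "c * ?S \<le> exp (c * ?S)"
      using exp_ge_add_one_self[of "c * ?S"] by linarith
    ultimately have "c * ?S * (cmod (f w))\<^sup>2 \<le> D"
      by (meson mult_right_mono order_trans zero_le_power2)
    then show ?thesis using c w by (simp add: field_simps)
  qed
  show ?thesis
    by (rule bounded_imp_summable[OF nn]) (use le[of "Suc _"] in \<open>simp only: lessThan_Suc_atMost\<close>)
qed

section \<open>Orbits approaching a parabolic boundary fixed point\<close>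

text \<open>The coordinate \<open>v\<close> maps the disc to the half-plane where Re v > 1/2 and
  sends \<open>\<omega>\<close> to infinity. Steps of \<open>v\<close> converge to
  \<open>\<omega> * b\<close>, so both Re v and the modulus of v grow linearly, and the Blaschke sum
  dominates a harmonic series.\<close>

lemma parabolic_orbit_not_blaschke:
  fixes z :: "nat \<Rightarrow> complex"
  assumes z: "\<And>n. z n \<in> unit_disc" and lim: "z \<longlonglongrightarrow> \<omega>" and \<omega>: "cmod \<omega> = 1"
    and q: "(\<lambda>n. (z (Suc n) - z n) / (z n - \<omega>)\<^sup>2) \<longlonglongrightarrow> b" and b: "Re (\<omega> * b) > 0"
  obtains M where "inj (\<lambda>k. z (M + k))" "\<not> summable (\<lambda>k. 1 - (cmod (z (M + k)))\<^sup>2)"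
proof -
  define v where "v n = \<omega> / (\<omega> - z n)" for n
  define Q where "Q n = (z (Suc n) - z n) / (z n - \<omega>)\<^sup>2" for n
  have \<omega>0: "\<omega> \<noteq> 0" using \<omega> by auto
  have ne: "z n \<noteq> \<omega>" for n using z[of n] \<omega> by auto
  have v0: "v n \<noteq> 0" for n using ne[of n] \<omega>0 by (simp add: v_def)
  have z_v: "z n = \<omega> * (1 - 1 / v n)" for n
    using ne[of n] \<omega>0 by (simp add: v_def field_simps)
  have norm_z: "1 - (cmod (z n))\<^sup>2 = (2 * Re (v n) - 1) / (cmod (v n))\<^sup>2" for n
  proof -
    have 1: "cmod (z n) = cmod (v n - 1) / cmod (v n)"
      unfolding z_v norm_mult \<omega> using v0[of n] by (simp add: diff_divide_distrib flip: norm_divide)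
    have 2: "(cmod (v n - 1))\<^sup>2 = (cmod (v n))\<^sup>2 - (2 * Re (v n) - 1)"
      unfolding cmod_power2 by (simp add: power2_eq_square algebra_simps)
    show ?thesis
      unfolding 1 power_divide 2 using v0[of n] by (simp add: diff_divide_distrib[of "_ ^ 2"])
  qed
  have Re_v: "2 * Re (v n) - 1 > 0" for n
  proof -
    have "0 < 1 - (cmod (z n))\<^sup>2" using z[of n] by (simp add: power_less_one_iff abs_square_less_1)
    then show ?thesis unfolding norm_z using v0[of n] by (simp add: zero_less_divide_iff)
  qed
  \<comment> \<open>An exact form of the increment in which every term has a visible limit:
    \<open>Q n\<close> tends to \<open>b\<close> and \<open>\<omega> - z n\<close> to 0.\<close>
  have diff: "v (Suc n) - v n = \<omega> * Q n / (1 - Q n * (\<omega> - z n))" for n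
  proof -
    define x y where "x = \<omega> - z n" and "y = \<omega> - z (Suc n)"
    have xy: "x \<noteq> 0" "y \<noteq> 0" using ne[of n] ne[of "Suc n"] by (auto simp: x_def y_def)
    have Q: "Q n = (x - y) / x\<^sup>2"
      by (simp add: Q_def x_def y_def power2_commute[of "z n"])
    have "1 - Q n * x = y / x"
      using xy by (simp add: Q power2_eq_square field_simps)
    then have "\<omega> * Q n / (1 - Q n * x) = \<omega> * ((x - y) / (x * y))"
      using xy by (simp add: Q power2_eq_square)
    also have "\<dots> = \<omega> / y - \<omega> / x"
      using xy by (simp add: field_simps)
    finally show ?thesis by (simp add: v_def x_def y_def)
  qed
  have "(\<lambda>n. \<omega> * Q n / (1 - Q n * (\<omega> - z n))) \<longlonglongrightarrow> \<omega> * b / (1 - b * (\<omega> - \<omega>))"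
    using q lim unfolding Q_def by (intro tendsto_intros) auto
  then have dlim: "(\<lambda>n. v (Suc n) - v n) \<longlonglongrightarrow> \<omega> * b" unfolding diff by simp
  \<comment> \<open>Half the limiting real drift is eventually exceeded, and one more than the
    limiting step length is eventually not reached.\<close>
  define \<beta> where "\<beta> = Re (\<omega> * b) / 2"
  define B where "B = cmod (\<omega> * b) + 1"
  have \<beta>: "\<beta> > 0" using b by (simp add: \<beta>_def)
  have B: "B > 0" by (simp add: B_def add_nonneg_pos)
  have "\<forall>\<^sub>F n in sequentially. \<beta> < Re (v (Suc n) - v n)"
    by (rule order_tendstoD(1)[OF tendsto_Re[OF dlim]]) (use b in \<open>simp add: \<beta>_def\<close>)
  moreover have "\<forall>\<^sub>F n in sequentially. cmod (v (Suc n) - v n) < B"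
    by (rule order_tendstoD(2)[OF tendsto_norm[OF dlim]]) (simp add: B_def)
  ultimately have "\<forall>\<^sub>F n in sequentially. \<beta> < Re (v (Suc n) - v n) \<and> cmod (v (Suc n) - v n) < B"
    by eventually_elim auto
  then obtain M where M: "\<And>n. n \<ge> M \<Longrightarrow> \<beta> < Re (v (Suc n) - v n) \<and> cmod (v (Suc n) - v n) < B"
    unfolding eventually_sequentially by blast
  have Re_ge: "Re (v (M + k)) \<ge> Re (v M) + real k * \<beta>" for k
  proof (induction k)
    case (Suc k)
    then show ?case using M[of "M + k"] by (simp add: algebra_simps)
  qed simp
  have norm_le: "cmod (v (M + k)) \<le> cmod (v M) + real k * B" for k
  proof (induction k)
    case (Suc k)
    have "cmod (v (M + Suc k)) \<le> cmod (v (M + k)) + cmod (v (Suc (M + k)) - v (M + k))"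
      by (metis add_Suc_right norm_triangle_sub)
    then show ?case using M[of "M + k"] Suc by (simp add: algebra_simps)
  qed simp
  have "strict_mono (\<lambda>k. Re (v (M + k)))"
    unfolding strict_mono_Suc_iff
  proof
    show "Re (v (M + k)) < Re (v (M + Suc k))" for k
      using M[of "M + k"] \<beta> by simp
  qed
  then have "inj (\<lambda>k. Re (v (M + k)))" by (rule strict_mono_imp_inj_on)
  then have inj: "inj (\<lambda>k. z (M + k))"
    unfolding inj_def v_def by metis
  \<comment> \<open>For \<open>k \<ge> 1\<close> the initial modulus is absorbed into the
    slope.\<close>
  define A where "A = cmod (v M) + B"
  have A: "A > 0" using B by (simp add: A_def add_nonneg_pos)
  have lower: "2 * \<beta> / A\<^sup>2 * inverse (real k) \<le> 1 - (cmod (z (M + k)))\<^sup>2" if k: "k \<ge> 1" for k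
  proof -
    have "cmod (v M) + real k * B \<le> real k * A"
      using k by (simp add: A_def distrib_left mult_right_le_one_le mult_le_cancel_right1)
    with norm_le[of k] have "(cmod (v (M + k)))\<^sup>2 \<le> (real k * A)\<^sup>2"
      by (intro power_mono) auto
    moreover have "2 * (real k * \<beta>) \<le> 2 * Re (v (M + k)) - 1"
      using Re_ge[of k] Re_v[of M] by simp
    ultimately have "2 * (real k * \<beta>) / (real k * A)\<^sup>2 \<le> (2 * Re (v (M + k)) - 1) / (cmod (v (M + k)))\<^sup>2"
      using v0[of "M + k"] Re_v[of "M + k"] \<beta> by (intro frac_le) auto
    then show ?thesis
      unfolding norm_z using k A by (simp add: field_simps power2_eq_square)
  qed
  have "\<not> summable (\<lambda>k. 1 - (cmod (z (M + k)))\<^sup>2)"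
  proof
    assume "summable (\<lambda>k. 1 - (cmod (z (M + k)))\<^sup>2)"
    then have "summable (\<lambda>k. 2 * \<beta> / A\<^sup>2 * inverse (real k))"
      by (rule summable_comparison_test'[where N = 1]) (use lower \<beta> in auto)
    then have "summable (\<lambda>k. inverse (real k))"
      using \<beta> A by (subst (asm) summable_cmult_iff) auto
    with not_summable_harmonic[where 'a=real] show False by (simp add: inverse_eq_divide)
  qed
  with inj show ?thesis by (rule that)
qed

text \<open>With first derivative 1 the linear terms of the expansion cancel along the orbit,
  leaving the quadratic coefficient. That \<open>c0\<close> equals \<open>\<omega>\<close> is not
  assumed: continuity along the orbit forces it.\<close>

lemma has_C2_at_orbit_difference_quotient:
  fixes z :: "nat \<Rightarrow> complex"
  assumes C2: "has_C2_at \<phi> \<omega> c0 1 c2" and \<omega>: "cmod \<omega> = 1"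
    and z: "\<And>n. z n \<in> unit_disc" "\<And>n. \<phi> (z n) = z (Suc n)" "z \<longlonglongrightarrow> \<omega>"
  shows "(\<lambda>n. (z (Suc n) - z n) / (z n - \<omega>)\<^sup>2) \<longlonglongrightarrow> c2 / 2"
proof -
  have ne: "z n \<noteq> \<omega>" for n using z(1)[of n] \<omega> by auto
  have fl: "filterlim z (at \<omega> within unit_disc) sequentially"
    unfolding filterlim_at using z ne by auto
  have "continuous (at \<omega> within insert \<omega> unit_disc) (\<phi>(\<omega> := c0))"
    using C2 unfolding has_C2_at_def by (blast intro: DERIV_continuous)
  then have "((\<phi>(\<omega> := c0)) \<longlongrightarrow> c0) (at \<omega> within insert \<omega> unit_disc)"
    by (simp add: continuous_within)
  then have "((\<phi>(\<omega> := c0)) \<longlongrightarrow> c0) (at \<omega> within unit_disc)"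
    by (rule tendsto_within_subset) auto
  from filterlim_compose[OF this fl] have "(\<lambda>n. z (Suc n)) \<longlonglongrightarrow> c0"
    using ne z(2) by simp
  moreover have "(\<lambda>n. z (Suc n)) \<longlonglongrightarrow> \<omega>"
    using z(3) by (rule LIMSEQ_Suc)
  ultimately have c0: "c0 = \<omega>" by (rule LIMSEQ_unique)
  have "((\<lambda>z. (\<phi> z - (c0 + 1 * (z - \<omega>) + c2 / 2 * (z - \<omega>)\<^sup>2)) / (z - \<omega>)\<^sup>2) \<longlongrightarrow> 0)
      (at \<omega> within unit_disc)"
    by (rule smalloD_tendsto[OF C2[unfolded has_C2_at_def, THEN conjunct2, THEN conjunct2]])
  from filterlim_compose[OF this fl]
  have "(\<lambda>n. (z (Suc n) - z n) / (z n - \<omega>)\<^sup>2 - c2 / 2) \<longlonglongrightarrow> 0"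
  proof (rule filterlim_cong[THEN iffD1, rotated -1])
    show "\<forall>\<^sub>F n in sequentially.
       (\<phi> (z n) - (c0 + 1 * (z n - \<omega>) + c2 / 2 * (z n - \<omega>)\<^sup>2)) / (z n - \<omega>)\<^sup>2 =
       (z (Suc n) - z n) / (z n - \<omega>)\<^sup>2 - c2 / 2"
      using ne by (intro always_eventually) (simp add: c0 z(2) diff_divide_distrib add_divide_distrib)
  qed simp_all
  then show ?thesis by (simp add: LIM_zero_iff)
qed

section \<open>Fractional powers of an eigenfunction and the spectrum\<close>

lemma eigenvalue_in_spectrum_hardy2:
  assumes "eigenvalue_hardy2 T \<mu>"
  shows "\<mu> \<in> spectrum_hardy2 T"
proof -
  obtain f where f: "f \<in> hardy2" "f \<noteq> (\<lambda>z. 0)" "T f = (\<lambda>z. \<mu> * f z)"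
    using assms unfolding eigenvalue_hardy2_def by blast
  have False if S: "bounded_operator_hardy2 S" "S (\<lambda>z. T f z - \<mu> * f z) = f" for S
  proof -
    \<comment> \<open>Homogeneity with scalar 0 shows that \<open>S\<close> kills the zero function,
      which the left inverse would have to send to \<open>f\<close>.\<close>
    have "S (\<lambda>z. 0 * f z) = (\<lambda>z. 0 * S f z)"
      using S(1) f(1) unfolding bounded_operator_hardy2_def by blast
    with S(2) f show False by simp
  qed
  with f(1) show ?thesis unfolding spectrum_hardy2_def by blast
qed

text \<open>The function is a branch of the power of \<open>f\<close> with exponent
  \<open>s\<close>. In the pointwise domination, \<open>s \<le> 1\<close> serves where Re h is
  nonnegative and \<open>0 \<le> s\<close> where it is negative.\<close>

lemma exp_scaled_logarithm_hardy2:
  fixes s :: real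
  assumes f: "f \<in> hardy2" and h: "h holomorphic_on unit_disc"
    and fh: "\<And>z. z \<in> unit_disc \<Longrightarrow> exp (h z) = f z" and s: "0 \<le> s" "s \<le> 1"
  shows "(\<lambda>z. if z \<in> unit_disc then exp (of_real s * h z) else 0) \<in> hardy2"
proof -
  let ?g = "\<lambda>z. if z \<in> unit_disc then exp (of_real s * h z) else 0"
  have "(\<lambda>z. exp (of_real s * h z)) holomorphic_on unit_disc"
    by (intro holomorphic_intros h)
  then have g: "?g holomorphic_on unit_disc"
    by (rule holomorphic_transform) simp
  have fhol: "f holomorphic_on unit_disc" using f by (simp add: hardy2_def)
  obtain K where K: "\<And>r. 0 \<le> r \<Longrightarrow> r < 1 \<Longrightarrow> circle_mean f r \<le> K"
    using f hardy2_coeff_iff_circle_mean[OF fhol] by (auto simp: hardy2_def)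
  have "circle_mean ?g r \<le> 1 + K" if r: "0 \<le> r" "r < 1" for r
  proof -
    have "circle_mean ?g r \<le> integral {0..1} (\<lambda>t. 1 + (cmod (f (of_real r * cis (2 * pi * t))))\<^sup>2)"
      unfolding circle_mean_def
    proof (rule integral_le)
      show "(\<lambda>t. (cmod (?g (of_real r * cis (2 * pi * t))))\<^sup>2) integrable_on {0..1}"
        by (rule circle_mean_integrable[OF g r])
      show "(\<lambda>t. 1 + (cmod (f (of_real r * cis (2 * pi * t))))\<^sup>2) integrable_on {0..1}"
        by (intro integrable_add circle_mean_integrable[OF fhol r] integrable_const_ivl)
      fix t :: real
      let ?z = "of_real r * cis (2 * pi * t)"
      have z: "?z \<in> unit_disc" by (rule circle_point_in_disc[OF r])
      have "s * Re (h ?z) \<le> max 0 (Re (h ?z))"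
      proof (cases "Re (h ?z) \<ge> 0")
        case True
        then show ?thesis using s by (simp add: mult_left_le_one_le)
      next
        case False
        then show ?thesis using s by (simp add: mult_nonneg_nonpos)
      qed
      then have "(exp (s * Re (h ?z)))\<^sup>2 \<le> (exp (max 0 (Re (h ?z))))\<^sup>2"
        by (intro power_mono) auto
      also have "\<dots> \<le> 1 + (exp (Re (h ?z)))\<^sup>2"
        by (simp add: max_def)
      finally show "(cmod (?g ?z))\<^sup>2 \<le> 1 + (cmod (f ?z))\<^sup>2"
        using z by (simp flip: fh[OF z])
    qed
    also have "\<dots> = 1 + circle_mean f r"
      unfolding circle_mean_def
      by (subst integral_add) (use circle_mean_integrable[OF fhol r] in \<open>auto intro: integrable_const_ivl\<close>)
    finally show ?thesis using K[OF r] by linarith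
  qed
  with g show ?thesis
    unfolding hardy2_def using hardy2_coeff_iff_circle_mean[OF g] by auto
qed

theorem proposition3p5:
  fixes \<phi> :: "complex \<Rightarrow> complex" and \<omega> c0 c1 c2 \<mu> :: complex
  assumes "analytic_selfmap \<phi>"
    and "denjoy_wolff_point \<phi> \<omega>"
    and "\<omega> \<in> sphere 0 1"
    and "has_C2_at \<phi> \<omega> c0 c1 c2"
    and "c1 = 1"
    and "Re (\<omega> * c2) > 0"
    and "\<mu> \<notin> {0, 1}"
    and "eigenvalue_hardy2 (comp_op \<phi>) \<mu>"
  shows "\<not> \<mu> isolated_in spectrum_hardy2 (comp_op \<phi>)"
proof
  assume iso: "\<mu> isolated_in spectrum_hardy2 (comp_op \<phi>)"
  have \<phi>: "\<phi> holomorphic_on unit_disc" and maps: "\<And>z. z \<in> unit_disc \<Longrightarrow> \<phi> z \<in> unit_disc"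
    using assms(1) unfolding analytic_selfmap_def by (simp, blast)
  have \<omega>: "cmod \<omega> = 1" using assms(3) by simp
  obtain f where f: "f \<in> hardy2" "f \<noteq> (\<lambda>z. 0)" "comp_op \<phi> f = (\<lambda>z. \<mu> * f z)"
    using assms(8) unfolding eigenvalue_hardy2_def by blast
  have fhol: "f holomorphic_on unit_disc" using f(1) by (simp add: hardy2_def)
  have eig: "f (\<phi> z) = \<mu> * f z" if "z \<in> unit_disc" for z
    using fun_cong[OF f(3), of z] that by (simp add: comp_op_def)
  have nonzero: "f z0 \<noteq> 0" if z0: "z0 \<in> unit_disc" for z0
  proof
    assume 0: "f z0 = 0"
    define z where "z n = (\<phi> ^^ n) z0" for n
    have z: "z n \<in> unit_disc" for n
      by (induction n) (use z0 maps in \<open>auto simp: z_def\<close>)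
    have fz: "f (z n) = 0" for n
      by (induction n) (use 0 eig z in \<open>auto simp: z_def\<close>)
    have lim: "z \<longlonglongrightarrow> \<omega>"
      using assms(2) z0 unfolding denjoy_wolff_point_def z_def by blast
    have "\<phi> (z n) = z (Suc n)" for n
      by (simp add: z_def)
    with assms(4,5) \<omega> z lim have "(\<lambda>n. (z (Suc n) - z n) / (z n - \<omega>)\<^sup>2) \<longlonglongrightarrow> c2 / 2"
      by (intro has_C2_at_orbit_difference_quotient[of \<phi> _ c0]) auto
    moreover have "Re (\<omega> * (c2 / 2)) > 0" using assms(6) by simp
    ultimately obtain M where M: "inj (\<lambda>k. z (M + k))"
        "\<not> summable (\<lambda>k. 1 - (cmod (z (M + k)))\<^sup>2)"
      using parabolic_orbit_not_blaschke[OF z lim \<omega>] by blast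
    obtain w where "f w \<noteq> 0" using f(2) by blast
    with hardy2_zeros_blaschke[OF f(1), of "\<lambda>k. z (M + k)"] z fz M show False by blast
  qed
  obtain h where h: "h holomorphic_on unit_disc" "\<And>z. z \<in> unit_disc \<Longrightarrow> exp (h z) = f z"
    by (rule holomorphic_logarithm_exists[of unit_disc f 0]) (use fhol nonzero in auto)
  define d where "d z = h (\<phi> z) - h z" for z
  have "(h \<circ> \<phi>) holomorphic_on unit_disc"
    by (rule holomorphic_on_compose_gen[OF \<phi> h(1)]) (use maps in auto)
  then have dhol: "d holomorphic_on unit_disc"
    unfolding d_def using h(1) by (auto intro!: holomorphic_intros simp: o_def)
  have exp_d: "exp (d z) = \<mu>" if "z \<in> unit_disc" for z
    using eig[OF that] nonzero[OF that] h(2)[OF that] h(2)[OF maps[OF that]]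
    by (simp add: d_def exp_diff)
  \<comment> \<open>Since \<open>exp (d z)\<close> is constant and exp has no zeros, the chain rule
    gives derivative 0 for \<open>d\<close> on the convex disc.\<close>
  have "\<exists>c. \<forall>z\<in>unit_disc. d z = c"
  proof (rule has_field_derivative_zero_constant)
    fix z assume z: "z \<in> unit_disc"
    have D: "(d has_field_derivative deriv d z) (at z)"
      by (rule holomorphic_derivI[OF dhol]) (use z in auto)
    have "((\<lambda>z. exp (d z)) has_field_derivative exp (d z) * deriv d z) (at z)"
      by (rule DERIV_chain2[OF DERIV_exp D])
    moreover have "((\<lambda>z. exp (d z)) has_field_derivative 0) (at z)"
      by (rule has_field_derivative_transform_within_open[of "\<lambda>_. \<mu>" _ _ unit_disc])
         (use exp_d z in auto)
    ultimately have "exp (d z) * deriv d z = 0" by (rule DERIV_unique)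
    with D show "(d has_field_derivative 0) (at z within unit_disc)"
      by (auto intro: has_field_derivative_at_within)
  qed simp
  then obtain c where c: "\<And>z. z \<in> unit_disc \<Longrightarrow> h (\<phi> z) = h z + c"
    unfolding d_def by (metis add.commute diff_add_cancel)
  have exp_c: "exp c = \<mu>" using exp_d[of 0] c[of 0] by (simp add: d_def)
  with assms(7) have c0: "c \<noteq> 0" by auto
  have spec: "exp (of_real s * c) \<in> spectrum_hardy2 (comp_op \<phi>)" if s: "0 \<le> s" "s \<le> 1" for s
  proof (rule eigenvalue_in_spectrum_hardy2)
    let ?g = "\<lambda>z. if z \<in> unit_disc then exp (of_real s * h z) else 0"
    have "?g \<in> hardy2"
      by (rule exp_scaled_logarithm_hardy2[OF f(1) h s])
    moreover have "?g \<noteq> (\<lambda>z. 0)"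
      by (metis centre_in_ball exp_not_eq_zero zero_less_one)
    moreover have "comp_op \<phi> ?g = (\<lambda>z. exp (of_real s * c) * ?g z)"
      using maps c by (auto simp: comp_op_def fun_eq_iff exp_add distrib_left simp del: mem_ball)
    ultimately show "eigenvalue_hardy2 (comp_op \<phi>) (exp (of_real s * c))"
      unfolding eigenvalue_hardy2_def by blast
  qed
  obtain e where e: "e > 0" "\<And>y. y \<in> spectrum_hardy2 (comp_op \<phi>) \<Longrightarrow> dist \<mu> y < e \<Longrightarrow> y = \<mu>"
    using isolated_inE_dist[OF iso] by blast
  \<comment> \<open>Two conditions hold for s near 1: \<open>exp (of_real s * c)\<close> is within
    \<open>e\<close> of \<open>\<mu>\<close>, hence equal to it, and \<open>(1 - s) * c\<close> is
    shorter than the period \<open>2 * pi\<close> of exp. A number of that size with exponential 1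
    must be 0, contradicting \<open>c \<noteq> 0\<close>.\<close>
  have "((\<lambda>s. exp (of_real s * c)) \<longlongrightarrow> exp (of_real 1 * c)) (at_left (1::real))"
    by (intro tendsto_intros)
  then have "\<forall>\<^sub>F s::real in at_left 1. dist (exp (of_real s * c)) \<mu> < e"
    using e(1) exp_c by (auto dest: tendstoD)
  moreover have "((\<lambda>s. (1 - s) * cmod c) \<longlongrightarrow> (1 - 1) * cmod c) (at_left (1::real))"
    by (intro tendsto_intros)
  then have "\<forall>\<^sub>F s in at_left 1. (1 - s) * cmod c < 2 * pi"
    by (rule order_tendstoD) simp
  moreover have "\<forall>\<^sub>F s::real in at_left 1. s \<in> {0<..<1}"
    by (rule eventually_at_left_real) simp
  ultimately have "\<forall>\<^sub>F s::real in at_left 1. False"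
  proof eventually_elim
    case (elim s)
    then have "exp (of_real s * c) = exp c"
      using e(2)[OF spec[of s]] exp_c by (auto simp: dist_commute)
    then have "exp (of_real (1 - s) * c) = 1"
      by (simp add: left_diff_distrib exp_diff)
    then obtain n :: int where n: "Re (of_real (1 - s) * c) = 0" "Im (of_real (1 - s) * c) = of_int (2 * n) * pi"
      unfolding exp_eq_1 by blast
    have "\<bar>Im (of_real (1 - s) * c)\<bar> \<le> cmod (of_real (1 - s) * c)"
      by (rule abs_Im_le_cmod)
    also have "\<dots> < 2 * pi" unfolding norm_mult norm_of_real using elim by simp
    finally have "\<bar>real_of_int n\<bar> < 1" unfolding n(2) by (simp add: abs_mult)
    then have "n = 0" by linarith
    with n have "of_real (1 - s) * c = 0" by (simp add: complex_eq_iff)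
    with c0 elim show False by simp
  qed
  then show False by simp
qed

end
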